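(* Let $K$ be a field and let $H=(H^0,H^1,s,r)$ be a hypergraph for which there is an $h\in H^1$ such that $|s(h)|,|r(h)|\geq 2$ and moreover $s(h)$ is a proper multiset, or $r(h)$ is a proper multiset, or $s(h)$ and $r(h)$ are sets with nonempty intersection. Then $L_K(H)$ is neither left nor right Noetherian.
   Context: Algebras are associative but not necessarily unital. A multiset over a set $Y$ is a function $M:Y\to\mathbb N_0$; its support is $M_{\mathrm{supp}}=\{y\in Y\mid M(y)>0\}$. $\mathrm{Mult}(Y)$ is the set of multisets over $Y$ with finite, nonempty support, and $|M|=\sum_{y\in M_{\mathrm{supp}}}M(y)$. A multiset $M$ is called a set, and identified with $M_{\mathrm{supp}}$, if $M(y)\le1$ for all $y$; otherwise it is called a proper multiset. A (directed) hypergraph is a quadruple $H=(H^0,H^1,s,r)$ where $H^0,H^1$ are sets and $s,r:H^1\to\mathrm{Mult}(H^0)$ are maps. For each $h\in H^1$ fix listings with multiplicity $s(h)=\{s(h)_1,\dots,s(h)_{|s(h)|}\}$ and $r(h)=\{r(h)_1,\dots,r(h)_{|r(h)|}\}$. The Leavitt path algebra $L_K(H)$ is the (not necessarily unital) $K$-algebra presented by the generators $v,h_{ij},h_{ij}^*$ ($v\in H^0$, $h\in H^1$, $1\le i\le|s(h)|$, $1\le j\le|r(h)|$) and the relations: (i) $uv=\delta_{uv}u$ ($u,v\in H^0$); (ii) $s(h)_ih_{ij}=h_{ij}=h_{ij}r(h)_j$ and $r(h)_jh_{ij}^*=h_{ij}^*=h_{ij}^*s(h)_i$ for all $h,i,j$;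 (iii) $\sum_{k=1}^{|r(h)|}h_{ik}h_{jk}^*=\delta_{ij}s(h)_i$ ($h\in H^1$, $1\le i,j\le|s(h)|$); (iv) $\sum_{k=1}^{|s(h)|}h_{ki}^*h_{kj}=\delta_{ij}r(h)_i$ ($h\in H^1$, $1\le i,j\le|r(h)|$). *)

theory Defs
  imports "HOL-Algebra.QuotRing" "HOL-Algebra.Module"
    "HOL-Library.Multiset" "HOL-Library.Poly_Mapping"
begin

text \<open>
  A not necessarily unital algebra over a field \<open>'k\<close> is represented by the record type
  \<open>('k, 'a) module\<close> of HOL-Algebra. That record type has a field \<open>one\<close>, whose value is
  arbitrary here: it is only used to fill the same field of a quotient.

  Ideals of an algebra are linear subspaces. The library locale \<open>ideal\<close> (and hence \<open>genideal\<close>)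
  is not applicable, since it presupposes a unital ring.
\<close>

definition linear_subspace :: "('k::field, 'a) module \<Rightarrow> 'a set \<Rightarrow> bool" where
  "linear_subspace A I \<longleftrightarrow>
     additive_subgroup I A \<and> (\<forall>c. \<forall>x\<in>I. c \<odot>\<^bsub>A\<^esub> x \<in> I)"

definition left_ideal :: "('k::field, 'a) module \<Rightarrow> 'a set \<Rightarrow> bool" where
  "left_ideal A I \<longleftrightarrow>
     linear_subspace A I \<and> (\<forall>a\<in>carrier A. \<forall>x\<in>I. a \<otimes>\<^bsub>A\<^esub> x \<in> I)"

definition right_ideal :: "('k::field, 'a) module \<Rightarrow> 'a set \<Rightarrow> bool" where
  "right_ideal A I \<longleftrightarrow>
     linear_subspace A I \<and> (\<forall>a\<in>carrier A. \<forall>x\<in>I. x \<otimes>\<^bsub>A\<^esub> a \<in> I)"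

definition two_sided_ideal :: "('k::field, 'a) module \<Rightarrow> 'a set \<Rightarrow> bool" where
  "two_sided_ideal A I \<longleftrightarrow> left_ideal A I \<and> right_ideal A I"

definition left_noetherian :: "('k::field, 'a) module \<Rightarrow> bool" where
  "left_noetherian A \<longleftrightarrow>
     (\<forall>I :: nat \<Rightarrow> 'a set. (\<forall>n. left_ideal A (I n)) \<and> (\<forall>n. I n \<subseteq> I (Suc n))
        \<longrightarrow> (\<exists>N. \<forall>n\<ge>N. I n = I N))"

definition right_noetherian :: "('k::field, 'a) module \<Rightarrow> bool" where
  "right_noetherian A \<longleftrightarrow>
     (\<forall>I :: nat \<Rightarrow> 'a set. (\<forall>n. right_ideal A (I n)) \<and> (\<forall>n. I n \<subseteq> I (Suc n))
        \<longrightarrow> (\<exists>N. \<forall>n\<ge>N. I n = I N))"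

definition ideal_generated :: "('k::field, 'a) module \<Rightarrow> 'a set \<Rightarrow> 'a set" where
  "ideal_generated A S = \<Inter> {I. two_sided_ideal A I \<and> S \<subseteq> I}"

text \<open>The ring structure of the quotient is that of \<open>A Quot I\<close>; only scalar multiplication is added.\<close>

definition quotient_algebra :: "('k::field, 'a) module \<Rightarrow> 'a set \<Rightarrow> ('k, 'a set) module" where
  "quotient_algebra A I =
     ring.extend (A Quot I)
       (module.fields (\<lambda>c X. \<Union>x\<in>X. I +>\<^bsub>A\<^esub> (c \<odot>\<^bsub>A\<^esub> x)))"

text \<open>
  The wrapper type for words provides concatenation as a \<open>monoid_add\<close> operation, so that
  \<open>'x word \<Rightarrow>\<^sub>0 'k\<close> with the convolution product is the free unital algebra on \<open>'x\<close>.
\<close>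

datatype 'x word = Word (letters: "'x list")

instantiation word :: (type) monoid_add
begin

definition zero_word :: "'x word" where
  "zero_word = Word []"

definition plus_word :: "'x word \<Rightarrow> 'x word \<Rightarrow> 'x word" where
  "plus_word v w = Word (letters v @ letters w)"

instance
  by standard (simp_all add: zero_word_def plus_word_def)

end

text \<open>
  The free not necessarily unital algebra on \<open>X\<close> is spanned by the nonempty words over \<open>X\<close>.
  (Its record field \<open>one\<close> lies outside the carrier and is irrelevant.)
\<close>

definition free_algebra :: "'x set \<Rightarrow> ('k::field, 'x word \<Rightarrow>\<^sub>0 'k) module" where
  "free_algebra X =
     \<lparr>carrier = {p. \<forall>w\<in>Poly_Mapping.keys p. letters w \<noteq> [] \<and> set (letters w) \<subseteq> X},
      monoid.mult = (*), one = 1, zero = 0, add = (+),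
      smult = (\<lambda>c p. Poly_Mapping.single 0 c * p)\<rparr>"

definition gen :: "'x \<Rightarrow> 'x word \<Rightarrow>\<^sub>0 'k::field" where
  "gen x = Poly_Mapping.single (Word [x]) 1"

definition presented_algebra ::
    "'x set \<Rightarrow> ('x word \<Rightarrow>\<^sub>0 'k::field) set \<Rightarrow> ('k, ('x word \<Rightarrow>\<^sub>0 'k) set) module" where
  "presented_algebra X R =
     quotient_algebra (free_algebra X) (ideal_generated (free_algebra X) R)"

record ('v, 'h) hypergraph_data =
  verts :: "'v set"
  edges :: "'h set"
  src :: "'h \<Rightarrow> 'v multiset"
  rng :: "'h \<Rightarrow> 'v multiset"

definition Mult :: "'v set \<Rightarrow> 'v multiset set" where
  "Mult Y = {M. M \<noteq> {#} \<and> set_mset M \<subseteq> Y}"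

definition hypergraph :: "('v, 'h) hypergraph_data \<Rightarrow> bool" where
  "hypergraph H \<longleftrightarrow> (\<forall>h\<in>edges H. src H h \<in> Mult (verts H) \<and> rng H h \<in> Mult (verts H))"

definition is_set_mset :: "'v multiset \<Rightarrow> bool" where
  "is_set_mset M \<longleftrightarrow> (\<forall>y. count M y \<le> 1)"

abbreviation proper_mset :: "'v multiset \<Rightarrow> bool" where
  "proper_mset M \<equiv> \<not> is_set_mset M"

definition listings ::
    "('v, 'h) hypergraph_data \<Rightarrow> ('h \<Rightarrow> 'v list) \<Rightarrow> ('h \<Rightarrow> 'v list) \<Rightarrow> bool" where
  "listings H sl rl \<longleftrightarrow> (\<forall>h\<in>edges H. mset (sl h) = src H h \<and> mset (rl h) = rng H h)"

text \<open>
  \<open>Edge h i j\<close> and \<open>Star h i j\<close> stand for $h_{ij}$ and $h_{ij}^*$. Indices start at \<open>0\<close>, as list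
  positions do.
\<close>

datatype ('v, 'h) lpa_gen = Vertex 'v | Edge 'h nat nat | Star 'h nat nat

definition lpa_gens ::
    "('v, 'h) hypergraph_data \<Rightarrow> ('h \<Rightarrow> 'v list) \<Rightarrow> ('h \<Rightarrow> 'v list) \<Rightarrow> ('v, 'h) lpa_gen set" where
  "lpa_gens H sl rl =
     Vertex ` verts H
     \<union> {Edge h i j | h i j. h \<in> edges H \<and> i < length (sl h) \<and> j < length (rl h)}
     \<union> {Star h i j | h i j. h \<in> edges H \<and> i < length (sl h) \<and> j < length (rl h)}"

text \<open>A relation \<open>p = q\<close> is represented by the element \<open>p - q\<close>.\<close>

definition lpa_rels ::
    "('v, 'h) hypergraph_data \<Rightarrow> ('h \<Rightarrow> 'v list) \<Rightarrow> ('h \<Rightarrow> 'v list)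
       \<Rightarrow> (('v, 'h) lpa_gen word \<Rightarrow>\<^sub>0 'k::field) set" where
  "lpa_rels H sl rl =
     {gen (Vertex u) * gen (Vertex v) - (if u = v then gen (Vertex u) else 0) | u v.
        u \<in> verts H \<and> v \<in> verts H}
   \<union> (\<Union>h\<in>edges H. \<Union>i\<in>{..<length (sl h)}. \<Union>j\<in>{..<length (rl h)}.
        {gen (Vertex (sl h ! i)) * gen (Edge h i j) - gen (Edge h i j),
         gen (Edge h i j) * gen (Vertex (rl h ! j)) - gen (Edge h i j),
         gen (Vertex (rl h ! j)) * gen (Star h i j) - gen (Star h i j),
         gen (Star h i j) * gen (Vertex (sl h ! i)) - gen (Star h i j)})
   \<union> {(\<Sum>k<length (rl h). gen (Edge h i k) * gen (Star h j k))
         - (if i = j then gen (Vertex (sl h ! i)) else 0) | h i j.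
        h \<in> edges H \<and> i < length (sl h) \<and> j < length (sl h)}
   \<union> {(\<Sum>k<length (sl h). gen (Star h k i) * gen (Edge h k j))
         - (if i = j then gen (Vertex (rl h ! i)) else 0) | h i j.
        h \<in> edges H \<and> i < length (rl h) \<and> j < length (rl h)}"

definition leavitt_path_algebra ::
    "('v, 'h) hypergraph_data \<Rightarrow> ('h \<Rightarrow> 'v list) \<Rightarrow> ('h \<Rightarrow> 'v list)
       \<Rightarrow> ('k::field, (('v, 'h) lpa_gen word \<Rightarrow>\<^sub>0 'k) set) module" where
  "leavitt_path_algebra H sl rl = presented_algebra (lpa_gens H sl rl) (lpa_rels H sl rl)"

end

theory Submission
  imports Defs Complex_Main "HOL-Library.Function_Algebras" "HOL-Library.Countable_Set"
begin

text \<open>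
  The algebra is not Noetherian because it has a representation in which elements supported at one
  vertex \<open>v\<close> act as a shift. A representation assigns to each vertex a space of sequences
  \<open>nat \<Rightarrow> 'k\<close> and to each hyperedge \<open>h\<close> an isomorphism between the direct sums over \<open>r(h)\<close> and
  over \<open>s(h)\<close>; as all these sums are isomorphic, the isomorphism for one hyperedge \<open>h\<close> is at our
  disposal. If \<open>s(h)\<^sub>p = s(h)\<^sub>q = v\<close> with \<open>p \<noteq> q\<close>, then \<open>h\<^sub>p\<^sub>y h\<^sub>q\<^sub>y\<^sup>*\<close> and \<open>h\<^sub>q\<^sub>y h\<^sub>q\<^sub>y\<^sup>*\<close> are blocks of
  the idempotent obtained by transporting the projection onto the \<open>y\<close>-th summand. Since
  \<open>|s(h)|, |r(h)| \<ge> 2\<close>, this idempotent can be chosen with \<open>(p, q)\<close> block the left shift \<open>A\<close> and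
  \<open>(q, q)\<close> block \<open>B A\<close>, where \<open>B\<close> is the right shift, or with \<open>(q, p)\<close> block \<open>B\<close> and \<open>(q, q)\<close>
  block \<open>B A\<close>. A repeated vertex in \<open>r(h)\<close> is treated with the roles of \<open>h\<^sub>i\<^sub>j\<close> and \<open>h\<^sub>i\<^sub>j\<^sup>*\<close>
  exchanged, and if \<open>s(h)\<^sub>q = r(h)\<^sub>y\<close>, then \<open>h\<^sub>q\<^sub>y\<close> and \<open>h\<^sub>q\<^sub>y\<^sup>*\<close> themselves can act as \<open>B\<close>
  and \<open>A\<close>.

  Let \<open>a\<close>, \<open>c\<close> act as \<open>A\<close>, \<open>B\<close>, let \<open>b\<close> act as \<open>1 - B A\<close>, the projection onto the first unit
  sequence \<open>e\<^sub>0\<close>, and let \<open>e\<^sub>k\<close> be the unit sequences at \<open>v\<close>. The left ideals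
  \<open>{x. x e\<^sub>k = 0 for all k \<ge> n}\<close> form a strictly ascending chain, because \<open>b a\<^sup>n\<close> annihilates \<open>e\<^sub>k\<close>
  for \<open>k > n\<close> but maps \<open>e\<^sub>n\<close> to \<open>e\<^sub>0\<close>. The right ideals of those \<open>x\<close> that map into the sequences
  vanishing at \<open>v\<close> from \<open>n\<close> on form a strictly ascending chain, because the image of \<open>c\<^sup>n b\<close> is
  spanned by \<open>e\<^sub>n\<close>.
\<close>

section \<open>Ideals of quotient algebras\<close>

text \<open>These are the laws by which products and scalar multiples of cosets are computed. The
  field \<open>one\<close> stays unconstrained, so the span of the nonempty words is an
  instance.\<close>

locale nonassoc_algebra = abelian_group A for A :: "('k::field, 'a) module" (structure) +
  assumes m_closed: "x \<in> carrier A \<Longrightarrow> y \<in> carrier A \<Longrightarrow> x \<otimes> y \<in> carrier A"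
    and l_distr: "\<lbrakk>x \<in> carrier A; y \<in> carrier A; z \<in> carrier A\<rbrakk> \<Longrightarrow> (x \<oplus> y) \<otimes> z = x \<otimes> z \<oplus> y \<otimes> z"
    and r_distr: "\<lbrakk>x \<in> carrier A; y \<in> carrier A; z \<in> carrier A\<rbrakk> \<Longrightarrow> z \<otimes> (x \<oplus> y) = z \<otimes> x \<oplus> z \<otimes> y"
    and smult_closed: "x \<in> carrier A \<Longrightarrow> c \<odot> x \<in> carrier A"
    and smult_r_distr: "x \<in> carrier A \<Longrightarrow> y \<in> carrier A \<Longrightarrow> c \<odot> (x \<oplus> y) = c \<odot> x \<oplus> c \<odot> y"

lemma quotient_algebra_simps:
  "carrier (quotient_algebra A I) = (\<lambda>x. I +>\<^bsub>A\<^esub> x) ` carrier A"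
  "X \<otimes>\<^bsub>quotient_algebra A I\<^esub> Y = rcoset_mult A I X Y"
  "X \<oplus>\<^bsub>quotient_algebra A I\<^esub> Y = X <+>\<^bsub>A\<^esub> Y"
  "\<zero>\<^bsub>quotient_algebra A I\<^esub> = I"
  "c \<odot>\<^bsub>quotient_algebra A I\<^esub> X = (\<Union>x\<in>X. I +>\<^bsub>A\<^esub> (c \<odot>\<^bsub>A\<^esub> x))"
  by (auto simp: quotient_algebra_def ring.defs module.defs FactRing_def A_RCOSETS_def')

text \<open>The carrier is itself a two-sided ideal containing \<open>S\<close>, so the intersection
  runs over a nonempty family and stays inside the carrier.\<close>

lemma (in nonassoc_algebra) two_sided_ideal_generated:
  assumes "S \<subseteq> carrier A"
  shows "two_sided_ideal A (ideal_generated A S)"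
proof -
  let ?\<I> = "{I. two_sided_ideal A I \<and> S \<subseteq> I}"
  have car: "two_sided_ideal A (carrier A)"
    using add.subgroup_self
    by (auto simp: two_sided_ideal_def left_ideal_def right_ideal_def linear_subspace_def
        additive_subgroup_def m_closed smult_closed)
  have "subgroup (\<Inter>?\<I>) (add_monoid A)"
  proof (rule add.subgroups_Inter)
    show "?\<I> \<noteq> {}" using car assms by blast
  qed (auto simp: two_sided_ideal_def left_ideal_def linear_subspace_def additive_subgroup_def)
  then show ?thesis
    unfolding ideal_generated_def two_sided_ideal_def left_ideal_def right_ideal_def
      linear_subspace_def additive_subgroup_def
    by blast
qed

section \<open>Cosets of a two-sided ideal\<close>

locale nonassoc_algebra_quotient = nonassoc_algebra +
  fixes I
  assumes I_ideal: "two_sided_ideal A I"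
begin

abbreviation "Q \<equiv> quotient_algebra A I"

sublocale abelian_subgroup I A
  using I_ideal abelian_group_axioms
  by (auto simp: two_sided_ideal_def left_ideal_def linear_subspace_def intro!: abelian_subgroupI3)

lemma I_mult:
  assumes "x \<in> carrier A" "i \<in> I"
  shows "x \<otimes> i \<in> I" "i \<otimes> x \<in> I"
  using assms I_ideal by (auto simp: two_sided_ideal_def left_ideal_def right_ideal_def)

lemma I_smult: "i \<in> I \<Longrightarrow> c \<odot> i \<in> I"
  using I_ideal by (auto simp: two_sided_ideal_def left_ideal_def linear_subspace_def)

text \<open>\<open>rcoset_mult\<close> is a union of cosets over all representatives. Expanding
  \<open>(i \<oplus> x) \<otimes> (j \<oplus> y)\<close> gives \<open>x \<otimes> y\<close> plus an
  element of \<open>I\<close>, so all members of the union coincide.\<close>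

lemma coset_mult:
  assumes "x \<in> carrier A" "y \<in> carrier A"
  shows "(I +> x) \<otimes>\<^bsub>Q\<^esub> (I +> y) = I +> (x \<otimes> y)"
proof -
  have "I +> (a \<otimes> b) = I +> (x \<otimes> y)" if "a \<in> I +> x" "b \<in> I +> y" for a b
  proof -
    obtain i j where i: "i \<in> I" "a = i \<oplus> x" and j: "j \<in> I" "b = j \<oplus> y"
      using \<open>a \<in> I +> x\<close> \<open>b \<in> I +> y\<close> by (auto simp: a_r_coset_def')
    have car: "i \<in> carrier A" "j \<in> carrier A"
      using i j by auto
    have "a \<otimes> b = (i \<otimes> (j \<oplus> y) \<oplus> x \<otimes> j) \<oplus> x \<otimes> y"
      using i j car assms by (simp add: l_distr r_distr m_closed a_ac)
    moreover have "i \<otimes> (j \<oplus> y) \<oplus> x \<otimes> j \<in> I"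
      using i(1) j(1) car assms by (simp add: I_mult)
    ultimately have "a \<otimes> b \<in> I +> (x \<otimes> y)"
      by (auto simp: a_r_coset_def')
    then show ?thesis
      using a_repr_independence'[of "a \<otimes> b" "x \<otimes> y"] assms by (simp add: m_closed)
  qed
  moreover have "x \<in> I +> x" "y \<in> I +> y"
    using assms by (auto intro: a_rcos_self)
  ultimately show ?thesis
    unfolding quotient_algebra_simps rcoset_mult_def by blast
qed

lemma coset_smult:
  assumes "x \<in> carrier A"
  shows "c \<odot>\<^bsub>Q\<^esub> (I +> x) = I +> (c \<odot> x)"
proof -
  have "I +> (c \<odot> a) = I +> (c \<odot> x)" if "a \<in> I +> x" for a
  proof -
    obtain i where i: "i \<in> I" "a = i \<oplus> x"
      using \<open>a \<in> I +> x\<close> by (auto simp: a_r_coset_def')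
    then have "c \<odot> a = c \<odot> i \<oplus> c \<odot> x"
      using assms by (simp add: smult_r_distr)
    then have "c \<odot> a \<in> I +> (c \<odot> x)"
      using I_smult[OF i(1)] by (auto simp: a_r_coset_def')
    then show ?thesis
      using a_repr_independence'[of "c \<odot> a" "c \<odot> x"] assms by (simp add: smult_closed)
  qed
  moreover have "x \<in> I +> x"
    using assms by (auto intro: a_rcos_self)
  ultimately show ?thesis
    unfolding quotient_algebra_simps by blast
qed

lemma coset_zero: "I +> \<zero> = \<zero>\<^bsub>Q\<^esub>"
  by (simp add: a_subset quotient_algebra_simps)

lemma coset_add:
  assumes "x \<in> carrier A" "y \<in> carrier A"
  shows "(I +> x) \<oplus>\<^bsub>Q\<^esub> (I +> y) = I +> (x \<oplus> y)"
  using assms by (simp add: a_rcos_sum quotient_algebra_simps)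

lemma coset_closed: "x \<in> carrier A \<Longrightarrow> I +> x \<in> carrier Q"
  by (simp add: quotient_algebra_simps)

lemma coset_cases:
  assumes "X \<in> carrier Q"
  obtains x where "x \<in> carrier A" "X = I +> x"
  using assms by (auto simp: quotient_algebra_simps)

lemma abelian_group_quotient: "abelian_group Q"
proof (rule abelian_groupI)
  fix X Y assume "X \<in> carrier Q" "Y \<in> carrier Q"
  then show "X \<oplus>\<^bsub>Q\<^esub> Y \<in> carrier Q" "X \<oplus>\<^bsub>Q\<^esub> Y = Y \<oplus>\<^bsub>Q\<^esub> X"
    by (auto elim!: coset_cases simp: coset_add coset_closed a_comm)
next
  fix X Y Z assume "X \<in> carrier Q" "Y \<in> carrier Q" "Z \<in> carrier Q"
  then show "X \<oplus>\<^bsub>Q\<^esub> Y \<oplus>\<^bsub>Q\<^esub> Z = X \<oplus>\<^bsub>Q\<^esub> (Y \<oplus>\<^bsub>Q\<^esub> Z)"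
    by (auto elim!: coset_cases simp: coset_add a_assoc)
next
  show "\<zero>\<^bsub>Q\<^esub> \<in> carrier Q"
    using coset_closed[OF a_Hcarr[OF zero_closed]] by (simp only: coset_zero)
next
  fix X assume "X \<in> carrier Q"
  then obtain x where x: "x \<in> carrier A" "X = I +> x" by (rule coset_cases)
  then show "\<zero>\<^bsub>Q\<^esub> \<oplus>\<^bsub>Q\<^esub> X = X"
    using coset_add[OF a_Hcarr[OF zero_closed] x(1)] by (simp only: coset_zero) simp
  have "(I +> (\<ominus> x)) \<oplus>\<^bsub>Q\<^esub> (I +> x) = \<zero>\<^bsub>Q\<^esub>"
    using coset_add[of "\<ominus> x" x] x(1) coset_zero by (simp add: l_neg)
  then show "\<exists>Y\<in>carrier Q. Y \<oplus>\<^bsub>Q\<^esub> X = \<zero>\<^bsub>Q\<^esub>"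
    using x coset_closed[of "\<ominus> x"] by auto
qed

section \<open>One-sided ideals of the quotient and their chains\<close>

lemma additive_subgroup_image:
  assumes "additive_subgroup J A" "I \<subseteq> J"
  shows "additive_subgroup ((\<lambda>x. I +> x) ` J) Q"
proof -
  interpret J: additive_subgroup J A by fact
  interpret Q: abelian_group Q by (rule abelian_group_quotient)
  show ?thesis
  proof (intro additive_subgroup.intro Q.add.subgroupI)
    show "(+>) I ` J \<subseteq> carrier Q"
      using J.a_subset coset_closed by blast
    show "(+>) I ` J \<noteq> {}"
      using J.zero_closed by blast
  next
    fix X assume "X \<in> (+>) I ` J"
    then obtain x where x: "x \<in> J" "X = I +> x" by blast
    have xA: "x \<in> carrier A" "\<ominus> x \<in> carrier A"
      using x(1) by auto
    have "(I +> (\<ominus> x)) \<oplus>\<^bsub>Q\<^esub> X = \<zero>\<^bsub>Q\<^esub>"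
      unfolding x(2) coset_add[OF xA(2,1)] l_neg[OF xA(1)] by (rule coset_zero)
    then have "\<ominus>\<^bsub>Q\<^esub> X = I +> (\<ominus> x)"
      using xA unfolding x(2) by (intro Q.minus_equality coset_closed)
    then show "\<ominus>\<^bsub>Q\<^esub> X \<in> (+>) I ` J"
      using J.a_inv_closed[OF x(1)] by blast
  next
    fix X Y assume "X \<in> (+>) I ` J" "Y \<in> (+>) I ` J"
    then obtain x y where xy: "x \<in> J" "X = I +> x" "y \<in> J" "Y = I +> y" by blast
    then have "X \<oplus>\<^bsub>Q\<^esub> Y = I +> (x \<oplus> y)"
      unfolding xy by (intro coset_add J.a_Hcarr)
    then show "X \<oplus>\<^bsub>Q\<^esub> Y \<in> (+>) I ` J"
      using J.a_closed[OF xy(1,3)] by blast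
  qed
qed

lemma linear_subspace_image:
  assumes "linear_subspace A J" "I \<subseteq> J"
  shows "linear_subspace Q ((\<lambda>x. I +> x) ` J)"
proof -
  interpret J: additive_subgroup J A
    using assms by (simp add: linear_subspace_def)
  show ?thesis
    using assms additive_subgroup_image
    by (auto simp: linear_subspace_def coset_smult)
qed

lemma left_ideal_image:
  assumes "left_ideal A J" "I \<subseteq> J"
  shows "left_ideal Q ((\<lambda>x. I +> x) ` J)"
proof -
  interpret J: additive_subgroup J A
    using assms by (simp add: left_ideal_def linear_subspace_def)
  have "X \<otimes>\<^bsub>Q\<^esub> Y \<in> (+>) I ` J" if "X \<in> carrier Q" "Y \<in> (+>) I ` J" for X Y
    using that assms unfolding quotient_algebra_simps(1)
    by (auto simp: coset_mult left_ideal_def)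
  then show ?thesis
    using assms by (auto simp: left_ideal_def linear_subspace_image)
qed

lemma right_ideal_image:
  assumes "right_ideal A J" "I \<subseteq> J"
  shows "right_ideal Q ((\<lambda>x. I +> x) ` J)"
proof -
  interpret J: additive_subgroup J A
    using assms by (simp add: right_ideal_def linear_subspace_def)
  have "Y \<otimes>\<^bsub>Q\<^esub> X \<in> (+>) I ` J" if "X \<in> carrier Q" "Y \<in> (+>) I ` J" for X Y
    using that assms unfolding quotient_algebra_simps(1)
    by (auto simp: coset_mult right_ideal_def)
  then show ?thesis
    using assms by (auto simp: right_ideal_def linear_subspace_image)
qed

text \<open>Since \<open>I \<subseteq> J\<close>, the subgroup \<open>J\<close> is a union of cosets
  of \<open>I\<close>. Hence strict inclusions between such subgroups survive in the
  quotient.\<close>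

lemma coset_in_image_iff:
  assumes "additive_subgroup J A" "I \<subseteq> J" "x \<in> carrier A"
  shows "I +> x \<in> (\<lambda>x. I +> x) ` J \<longleftrightarrow> x \<in> J"
proof
  interpret J: additive_subgroup J A by fact
  assume "I +> x \<in> (+>) I ` J"
  then obtain y where y: "y \<in> J" "I +> x = I +> y" by auto
  then have "x \<in> I +> y"
    using a_rcos_self[of x] assms(3) by simp
  then show "x \<in> J"
    using y(1) assms(2) by (auto simp: a_r_coset_def')
qed auto

text \<open>The images of the \<open>K n\<close> ascend and never stabilise: the coset of
  \<open>x n\<close> lies in the next image but, because \<open>K n\<close> contains
  \<open>I\<close>, not in the \<open>n\<close>-th.\<close>

lemma not_left_noetherianI:
  assumes K: "\<And>n. left_ideal A (K n)" "\<And>n. I \<subseteq> K n" "\<And>n. K n \<subseteq> K (Suc n)"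
    and x: "\<And>n. x n \<in> K (Suc n)" "\<And>n. x n \<notin> K n"
  shows "\<not> left_noetherian Q"
proof
  assume "left_noetherian Q"
  moreover have "\<forall>n. left_ideal Q ((+>) I ` K n)" "\<forall>n. (+>) I ` K n \<subseteq> (+>) I ` K (Suc n)"
    using left_ideal_image[OF K(1,2)] K(3) by blast+
  ultimately obtain N where "\<forall>n\<ge>N. (+>) I ` K n = (+>) I ` K N"
    unfolding left_noetherian_def by (elim allE[of _ "\<lambda>n. (+>) I ` K n"]) blast
  then have "(+>) I ` K (Suc N) = (+>) I ` K N"
    by (meson le_SucI order_refl)
  then have "I +> x N \<in> (+>) I ` K N"
    using imageI[OF x(1)[of N], of "\<lambda>x. I +> x"] by simp
  moreover have sub: "additive_subgroup (K n) A" for n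
    using K(1) by (simp add: left_ideal_def linear_subspace_def)
  moreover have "x N \<in> carrier A"
    using additive_subgroup.a_subset[OF sub] x(1) by blast
  ultimately show False
    using coset_in_image_iff[OF sub K(2)] x(2)[of N] by simp
qed

lemma not_right_noetherianI:
  assumes K: "\<And>n. right_ideal A (K n)" "\<And>n. I \<subseteq> K n" "\<And>n. K n \<subseteq> K (Suc n)"
    and x: "\<And>n. x n \<in> K (Suc n)" "\<And>n. x n \<notin> K n"
  shows "\<not> right_noetherian Q"
proof
  assume "right_noetherian Q"
  moreover have "\<forall>n. right_ideal Q ((+>) I ` K n)" "\<forall>n. (+>) I ` K n \<subseteq> (+>) I ` K (Suc n)"
    using right_ideal_image[OF K(1,2)] K(3) by blast+
  ultimately obtain N where "\<forall>n\<ge>N. (+>) I ` K n = (+>) I ` K N"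
    unfolding right_noetherian_def by (elim allE[of _ "\<lambda>n. (+>) I ` K n"]) blast
  then have "(+>) I ` K (Suc N) = (+>) I ` K N"
    by (meson le_SucI order_refl)
  then have "I +> x N \<in> (+>) I ` K N"
    using imageI[OF x(1)[of N], of "\<lambda>x. I +> x"] by simp
  moreover have sub: "additive_subgroup (K n) A" for n
    using K(1) by (simp add: right_ideal_def linear_subspace_def)
  moreover have "x N \<in> carrier A"
    using additive_subgroup.a_subset[OF sub] x(1) by blast
  ultimately show False
    using coset_in_image_iff[OF sub K(2)] x(2)[of N] by simp
qed

end

section \<open>Representations of free algebras on function spaces\<close>

lemma free_algebra_simps:
  "carrier (free_algebra X) = {p. \<forall>w\<in>Poly_Mapping.keys p. letters w \<noteq> [] \<and> set (letters w) \<subseteq> X}"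
  "p \<otimes>\<^bsub>free_algebra X\<^esub> q = p * q"
  "p \<oplus>\<^bsub>free_algebra X\<^esub> q = p + q"
  "\<zero>\<^bsub>free_algebra X\<^esub> = 0"
  "c \<odot>\<^bsub>free_algebra X\<^esub> p = Poly_Mapping.single 0 c * p"
  by (simp_all add: free_algebra_def)

abbreviation "free_carrier X \<equiv> carrier (free_algebra X)"

lemma gen_in_free: "x \<in> X \<Longrightarrow> gen x \<in> free_carrier X"
  by (simp add: free_algebra_simps gen_def)

lemma add_in_free: "p \<in> free_carrier X \<Longrightarrow> q \<in> free_carrier X \<Longrightarrow> p + q \<in> free_carrier X"
  using Poly_Mapping.keys_add[of p q] by (auto simp: free_algebra_simps)

lemma uminus_in_free: "p \<in> free_carrier X \<Longrightarrow> - p \<in> free_carrier X"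
  by (simp add: free_algebra_simps)

lemma diff_in_free: "p \<in> free_carrier X \<Longrightarrow> q \<in> free_carrier X \<Longrightarrow> p - q \<in> free_carrier X"
  using add_in_free[of p X "- q"] uminus_in_free[of q X] by simp

lemma mult_in_free: "p \<in> free_carrier X \<Longrightarrow> q \<in> free_carrier X \<Longrightarrow> p * q \<in> free_carrier X"
  using keys_mult[of p q] by (fastforce simp: free_algebra_simps plus_word_def)

lemma zero_in_free: "0 \<in> free_carrier X"
  by (simp add: free_algebra_simps)

lemma sum_in_free: "(\<And>i. i \<in> F \<Longrightarrow> p i \<in> free_carrier X) \<Longrightarrow> sum p F \<in> free_carrier X"
  by (induction F rule: infinite_finite_induct) (auto simp: zero_in_free add_in_free)

lemma smult_in_free: "p \<in> free_carrier X \<Longrightarrow> Poly_Mapping.single 0 c * p \<in> free_carrier X"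
  using keys_mult[of "Poly_Mapping.single 0 c" p] by (fastforce simp: free_algebra_simps zero_word_def plus_word_def split: if_splits)

lemma nonassoc_algebra_free: "nonassoc_algebra (free_algebra X)"
proof -
  have "abelian_group (free_algebra X)"
    using uminus_in_free
    by (intro abelian_groupI)
      (auto simp: free_algebra_simps(2-) add_in_free zero_in_free ac_simps intro!: bexI[of _ "- _"])
  then show ?thesis
    by (auto simp: nonassoc_algebra_def nonassoc_algebra_axioms_def free_algebra_simps(2-)
        mult_in_free smult_in_free algebra_simps)
qed

section \<open>Linear maps between function spaces\<close>

definition fscale :: "'k::field \<Rightarrow> ('i \<Rightarrow> 'k) \<Rightarrow> 'i \<Rightarrow> 'k" where
  "fscale c f = (\<lambda>i. c * f i)"

interpretation fscale: vector_space fscale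
  by standard (auto simp: fscale_def algebra_simps)

abbreviation flinear :: "(('i \<Rightarrow> 'k::field) \<Rightarrow> 'j \<Rightarrow> 'k) \<Rightarrow> bool" where
  "flinear \<equiv> Vector_Spaces.linear fscale fscale"

lemma flinear_iff:
  "flinear F \<longleftrightarrow> (\<forall>f g. F (f + g) = F f + F g) \<and> (\<forall>c f. F (fscale c f) = fscale c (F f))"
  unfolding Vector_Spaces.linear_iff by (simp add: fscale.vector_space_axioms)

lemma flinear_simps:
  assumes "flinear F"
  shows "F (f + g) = F f + F g" "F (f - g) = F f - F g" "F (- f) = - F f" "F 0 = 0"
    "F (fscale c f) = fscale c (F f)" "F (sum h I) = (\<Sum>i\<in>I. F (h i))"
proof -
  interpret module_hom fscale fscale F
    using assms by (simp add: linear_iff_module_hom)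
  show "F (f + g) = F f + F g" "F (f - g) = F f - F g" "F (- f) = - F f" "F 0 = 0"
    "F (fscale c f) = fscale c (F f)" "F (sum h I) = (\<Sum>i\<in>I. F (h i))"
    by (fact add diff neg zero scale sum)+
qed

lemma flinear_comp:
  assumes "flinear F" "flinear G"
  shows "flinear (\<lambda>f. F (G f))"
  unfolding flinear_iff by (simp add: flinear_simps[OF assms(1)] flinear_simps[OF assms(2)])

lemma flinear_add:
  assumes "flinear F" "flinear G"
  shows "flinear (\<lambda>f. F f + G f)"
  unfolding flinear_iff
  by (simp add: flinear_simps[OF assms(1)] flinear_simps[OF assms(2)]
      fscale.scale_right_distrib algebra_simps)

lemma flinear_uminus:
  assumes "flinear F"
  shows "flinear (\<lambda>f. - F f)"
  unfolding flinear_iff by (simp add: flinear_simps[OF assms])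

lemma flinear_diff: "flinear F \<Longrightarrow> flinear G \<Longrightarrow> flinear (\<lambda>f. F f - G f)"
  using flinear_add[of F "\<lambda>f. - G f"] flinear_uminus[of G] by simp

lemma flinear_zero: "flinear (\<lambda>f. 0)"
  by (simp add: flinear_iff)

lemma flinear_sum: "(\<And>i. i \<in> I \<Longrightarrow> flinear (F i)) \<Longrightarrow> flinear (\<lambda>f. \<Sum>i\<in>I. F i f)"
  by (induction I rule: infinite_finite_induct) (auto simp: flinear_zero flinear_add)

lemma flinear_fscale: "flinear (fscale c)"
  by (simp add: flinear_iff fscale.scale_right_distrib mult.commute)

text \<open>The representation of the free algebra that extends \<open>\<phi>\<close>. Letters act
  from right to left, so concatenation becomes composition, and the empty word acts as the
  identity.\<close>

definition act :: "('x \<Rightarrow> ('i \<Rightarrow> 'k) \<Rightarrow> 'i \<Rightarrow> 'k) \<Rightarrow> ('x word \<Rightarrow>\<^sub>0 'k::field) \<Rightarrow> ('i \<Rightarrow> 'k) \<Rightarrow> 'i \<Rightarrow> 'k" where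
  "act \<phi> p f = (\<Sum>w\<in>Poly_Mapping.keys p. fscale (Poly_Mapping.lookup p w) (foldr \<phi> (letters w) f))"

lemma act_superset:
  assumes "finite W" "Poly_Mapping.keys p \<subseteq> W"
  shows "act \<phi> p f = (\<Sum>w\<in>W. fscale (Poly_Mapping.lookup p w) (foldr \<phi> (letters w) f))"
  unfolding act_def using assms
  by (intro sum.mono_neutral_left) (auto simp: in_keys_iff)

lemma act_zero: "act \<phi> 0 f = 0"
  by (simp add: act_def)

lemma act_single: "act \<phi> (Poly_Mapping.single w c) f = fscale c (foldr \<phi> (letters w) f)"
  by (simp add: act_superset[of "{w}"])

lemma act_gen: "act \<phi> (gen x) f = \<phi> x f"
  by (simp add: gen_def act_single)

lemma act_add: "act \<phi> (p + q) f = act \<phi> p f + act \<phi> q f"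
proof -
  let ?W = "Poly_Mapping.keys p \<union> Poly_Mapping.keys q"
  have "act \<phi> r f = (\<Sum>w\<in>?W. fscale (Poly_Mapping.lookup r w) (foldr \<phi> (letters w) f))"
    if "r \<in> {p, q, p + q}" for r
    using that Poly_Mapping.keys_add[of p q] by (intro act_superset) auto
  then show ?thesis
    by (simp add: lookup_add fscale.scale_left_distrib sum.distrib)
qed

lemma act_diff: "act \<phi> (p - q) f = act \<phi> p f - act \<phi> q f"
  using act_add[of \<phi> "p - q" q f] by simp

lemma act_sum: "act \<phi> (sum p I) f = (\<Sum>i\<in>I. act \<phi> (p i) f)"
  by (induction I rule: infinite_finite_induct) (auto simp: act_add act_zero)

text \<open>Updating at a key outside the support amounts to adding a monomial, so additive
  statements reduce to monomials.\<close>

lemma poly_mapping_add_induct [case_names zero add]: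
  assumes "P 0" "\<And>w c p. P p \<Longrightarrow> P (Poly_Mapping.single w c + p)"
  shows "P p"
proof (induction p rule: update_induct)
  case const
  then show ?case by (rule assms)
next
  case (update p w c)
  then have "Poly_Mapping.update w c p = Poly_Mapping.single w c + p"
    by (intro poly_mapping_eqI) (auto simp: lookup_update lookup_add lookup_single in_keys_iff when_def)
  then show ?case using update by (simp add: assms)
qed

context
  fixes \<phi> :: "'x \<Rightarrow> ('i \<Rightarrow> 'k::field) \<Rightarrow> 'i \<Rightarrow> 'k"
  assumes flinear_gen: "\<And>x. flinear (\<phi> x)"
begin

lemma flinear_foldr: "flinear (foldr \<phi> xs)"
proof (induction xs)
  case Nil
  show ?case unfolding flinear_iff by simp
next
  case (Cons x xs)
  have "flinear (\<lambda>f. \<phi> x (foldr \<phi> xs f))"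
    by (rule flinear_comp[OF flinear_gen Cons.IH])
  then show ?case by (simp only: foldr.simps comp_def)
qed

lemma flinear_act: "flinear (act \<phi> p)"
  unfolding act_def[abs_def]
  by (intro flinear_sum flinear_comp[OF flinear_fscale] flinear_foldr)

text \<open>Both sides are additive in \<open>q\<close>, and for a monomial the concatenation of
  words becomes composition of operators.\<close>

lemma act_single_mult:
  "act \<phi> (Poly_Mapping.single w c * q) f = act \<phi> (Poly_Mapping.single w c) (act \<phi> q f)"
proof (induction q rule: poly_mapping_add_induct)
  case zero
  show ?case unfolding act_zero mult_zero_right flinear_simps(4)[OF flinear_act] ..
next
  case (add v d q)
  then show ?case
    by (simp add: distrib_left act_add flinear_simps[OF flinear_act] mult_single act_single
        flinear_simps[OF flinear_foldr] fscale.scale_right_distrib plus_word_def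
        del: plus_fun_apply)
qed

lemma act_mult: "act \<phi> (p * q) f = act \<phi> p (act \<phi> q f)"
  by (induction p rule: poly_mapping_add_induct)
    (simp_all add: distrib_right act_add act_zero act_single_mult)

lemma act_smult: "act \<phi> (Poly_Mapping.single 0 c * p) f = fscale c (act \<phi> p f)"
  by (simp add: act_mult act_single zero_word_def)

text \<open>Common source of both kinds of ideals: \<open>W = {0}\<close> gives the annihilator of
  \<open>F\<close>, and \<open>F = UNIV\<close> gives the elements whose image lies in
  \<open>W\<close>.\<close>

lemma linear_subspace_act:
  assumes "fscale.subspace W"
  shows "linear_subspace (free_algebra X) {p \<in> free_carrier X. \<forall>f\<in>F. act \<phi> p f \<in> W}"
proof -
  interpret nonassoc_algebra "free_algebra X :: ('k, 'x word \<Rightarrow>\<^sub>0 'k) module"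
    by (rule nonassoc_algebra_free)
  let ?J = "{p \<in> free_carrier X. \<forall>f\<in>F. act \<phi> p f \<in> W}"
  have "subgroup ?J (add_monoid (free_algebra X))"
  proof (rule add.subgroupI)
    fix p assume p: "p \<in> ?J"
    have "\<ominus>\<^bsub>free_algebra X\<^esub> p = - p"
      using p uminus_in_free[of p X]
      by (intro minus_equality) (auto simp: free_algebra_simps(3,4))
    moreover have "act \<phi> (- p) f \<in> W" if "f \<in> F" for f
      using p that act_diff[of \<phi> 0 p f] fscale.subspace_neg[OF assms] by (auto simp: act_zero)
    ultimately show "\<ominus>\<^bsub>free_algebra X\<^esub> p \<in> ?J"
      using p by (auto simp: uminus_in_free)
  qed (auto simp: free_algebra_simps(3) zero_in_free act_zero add_in_free act_add
      fscale.subspace_add[OF assms] fscale.subspace_0[OF assms] intro!: exI[of _ 0])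
  then show ?thesis
    by (auto simp: linear_subspace_def additive_subgroup_def free_algebra_simps(5) smult_in_free
        act_smult fscale.subspace_scale[OF assms])
qed

lemma left_ideal_act:
  "left_ideal (free_algebra X) {p \<in> free_carrier X. \<forall>f\<in>F. act \<phi> p f = 0}"
  using linear_subspace_act[OF fscale.subspace_single_0, of X F]
  by (auto simp: left_ideal_def free_algebra_simps(2) mult_in_free act_mult
      flinear_simps(4)[OF flinear_act])

text \<open>The image of \<open>p * a\<close> is contained in the image of \<open>p\<close>.\<close>

lemma right_ideal_act:
  assumes "fscale.subspace W"
  shows "right_ideal (free_algebra X) {p \<in> free_carrier X. \<forall>f. act \<phi> p f \<in> W}"
  using linear_subspace_act[OF assms, of X UNIV]
  by (auto simp: right_ideal_def free_algebra_simps(2) mult_in_free act_mult)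

section \<open>Presented algebras whose relations act as zero\<close>

context
  fixes X :: "'x set" and R :: "('x word \<Rightarrow>\<^sub>0 'k) set"
  assumes R_free: "R \<subseteq> free_carrier X"
    and act_R: "\<And>r f. r \<in> R \<Longrightarrow> act \<phi> r f = 0"
begin

text \<open>The annihilator of the whole space is a two-sided ideal and contains \<open>R\<close>,
  hence also the ideal that \<open>R\<close> generates.\<close>

lemma act_ideal_generated:
  assumes "p \<in> ideal_generated (free_algebra X) R"
  shows "p \<in> free_carrier X" "act \<phi> p f = 0"
proof -
  have "two_sided_ideal (free_algebra X) {p \<in> free_carrier X. \<forall>f. act \<phi> p f = 0}"
    using left_ideal_act[of X UNIV] right_ideal_act[OF fscale.subspace_single_0]
    by (simp add: two_sided_ideal_def)
  then have "p \<in> {p \<in> free_carrier X. \<forall>f. act \<phi> p f = 0}"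
    using assms R_free act_R unfolding ideal_generated_def by blast
  then show "p \<in> free_carrier X" "act \<phi> p f = 0" by auto
qed

lemma presented_algebra_quotient:
  "nonassoc_algebra_quotient (free_algebra X) (ideal_generated (free_algebra X) R)"
  using nonassoc_algebra_free nonassoc_algebra.two_sided_ideal_generated[OF nonassoc_algebra_free R_free]
  by (simp add: nonassoc_algebra_quotient_def nonassoc_algebra_quotient_axioms_def)

text \<open>The annihilators of the sets \<open>F n\<close> grow as these sets shrink, and
  \<open>x n\<close> belongs to the annihilator of \<open>F (Suc n)\<close> but not to that of
  \<open>F n\<close>.\<close>

lemma not_left_noetherian_presented:
  assumes "\<And>n. F (Suc n) \<subseteq> F n"
    and "\<And>n. x n \<in> free_carrier X"
    and "\<And>n f. f \<in> F (Suc n) \<Longrightarrow> act \<phi> (x n) f = 0"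
    and "\<And>n. \<exists>f\<in>F n. act \<phi> (x n) f \<noteq> 0"
  shows "\<not> left_noetherian (presented_algebra X R)"
  unfolding presented_algebra_def
proof (rule nonassoc_algebra_quotient.not_left_noetherianI[OF presented_algebra_quotient,
      where K = "\<lambda>n. {p \<in> free_carrier X. \<forall>f\<in>F n. act \<phi> p f = 0}" and x = x])
  show "left_ideal (free_algebra X) {p \<in> free_carrier X. \<forall>f\<in>F n. act \<phi> p f = 0}" for n
    by (rule left_ideal_act)
  show "{p \<in> free_carrier X. \<forall>f\<in>F n. act \<phi> p f = 0}
      \<subseteq> {p \<in> free_carrier X. \<forall>f\<in>F (Suc n). act \<phi> p f = 0}" for n
    using assms(1) by blast
qed (use assms(2-) in \<open>auto simp: act_ideal_generated\<close>)

lemma not_right_noetherian_presented: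
  assumes "\<And>n. fscale.subspace (W n)" "\<And>n. W n \<subseteq> W (Suc n)"
    and "\<And>n. x n \<in> free_carrier X"
    and "\<And>n f. act \<phi> (x n) f \<in> W (Suc n)"
    and "\<And>n. \<exists>f. act \<phi> (x n) f \<notin> W n"
  shows "\<not> right_noetherian (presented_algebra X R)"
  unfolding presented_algebra_def
proof (rule nonassoc_algebra_quotient.not_right_noetherianI[OF presented_algebra_quotient,
      where K = "\<lambda>n. {p \<in> free_carrier X. \<forall>f. act \<phi> p f \<in> W n}" and x = x])
  show "right_ideal (free_algebra X) {p \<in> free_carrier X. \<forall>f. act \<phi> p f \<in> W n}" for n
    using assms(1) by (rule right_ideal_act)
  show "{p \<in> free_carrier X. \<forall>f. act \<phi> p f \<in> W n}
      \<subseteq> {p \<in> free_carrier X. \<forall>f. act \<phi> p f \<in> W (Suc n)}" for n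
    using assms(2) by blast
qed (use assms(3-) fscale.subspace_0[OF assms(1)] in \<open>auto simp: act_ideal_generated\<close>)

end

end

section \<open>Invertible matrices of operators\<close>

text \<open>Relations (iii) and (iv) for operators. As \<open>S\<close> is indexed like the starred
  generators, it is the transpose of \<open>S\<close> that inverts the \<open>m\<close> by
  \<open>n\<close> matrix \<open>E\<close>.\<close>

definition leavitt_matrices ::
    "nat \<Rightarrow> nat \<Rightarrow> (nat \<Rightarrow> nat \<Rightarrow> ('i \<Rightarrow> 'k::field) \<Rightarrow> 'i \<Rightarrow> 'k) \<Rightarrow>
      (nat \<Rightarrow> nat \<Rightarrow> ('i \<Rightarrow> 'k) \<Rightarrow> 'i \<Rightarrow> 'k) \<Rightarrow> bool" where
  "leavitt_matrices m n E S \<longleftrightarrow>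
     (\<forall>i j. flinear (E i j) \<and> flinear (S i j)) \<and>
     (\<forall>i<m. \<forall>j<m. \<forall>f. (\<Sum>k<n. E i k (S j k f)) = (if i = j then f else 0)) \<and>
     (\<forall>i<n. \<forall>j<n. \<forall>f. (\<Sum>k<m. S k i (E k j f)) = (if i = j then f else 0))"

text \<open>This reduces a repeated vertex in the range of a hyperedge to one in the source.\<close>

lemma leavitt_matrices_swap:
  "leavitt_matrices m n E S \<Longrightarrow> leavitt_matrices n m (\<lambda>i j. S j i) (\<lambda>i j. E j i)"
  by (auto simp: leavitt_matrices_def)

text \<open>With \<open>T\<close> the elementary matrix that has \<open>N\<close> at position \<open>(p, q)\<close>, this replaces \<open>E\<close> by
  \<open>T E\<close>; as \<open>S\<close> is the transpose of the inverse of \<open>E\<close>, its row \<open>q\<close> changes.\<close>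
lemma leavitt_matrices_row_operation:
  assumes ES: "leavitt_matrices m n E S" and pq: "p < m" "q < m" "p \<noteq> q" and N: "flinear N"
  shows "leavitt_matrices m n (\<lambda>i j f. E i j f + (if i = p then N (E q j f) else 0))
           (\<lambda>i j f. S i j f - (if i = q then S p j (N f) else 0))"
proof -
  let ?E = "\<lambda>i j f. E i j f + (if i = p then N (E q j f) else 0)"
  let ?S = "\<lambda>i j f. S i j f - (if i = q then S p j (N f) else 0)"
  have lin: "flinear (E i j)" "flinear (S i j)" for i j
    using ES by (auto simp: leavitt_matrices_def)
  note simps = flinear_simps[OF lin(1)] flinear_simps[OF lin(2)] flinear_simps[OF N]
  have ESsum: "(\<Sum>k<n. E i k (S j k f)) = (if i = j then f else 0)" if "i < m" "j < m" for i j f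
    using ES that by (auto simp: leavitt_matrices_def)
  have SEsum: "(\<Sum>k<m. S k i (E k j f)) = (if i = j then f else 0)" if "i < n" "j < n" for i j f
    using ES that by (auto simp: leavitt_matrices_def)
  have "flinear (?E i j)" "flinear (?S i j)" for i j
    by (cases "i = p"; cases "i = q"; simp add: lin N flinear_add flinear_diff flinear_comp[of N]
        flinear_comp[of "S p j" N])+
  moreover have "(\<Sum>k<n. ?E i k (?S j k f)) = (if i = j then f else 0)" if ij: "i < m" "j < m" for i j f
  proof -
    have "(\<Sum>k<n. ?E i k (?S j k f)) =
        (\<Sum>k<n. E i k (S j k f)) - (if j = q then \<Sum>k<n. E i k (S p k (N f)) else 0)
        + (if i = p then N (\<Sum>k<n. E q k (S j k f))
            - (if j = q then N (\<Sum>k<n. E q k (S p k (N f))) else 0) else 0)"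
      by (auto simp: simps sum.distrib sum_subtractf)
    \<comment> \<open>The term with two factors \<open>N\<close> vanishes as
      \<open>p \<noteq> q\<close>; the two with one factor are both \<open>N f\<close>, at
      \<open>i = p\<close> and \<open>j = q\<close>, and cancel.\<close>
    also have "\<dots> = (if i = j then f else 0)"
      using ij pq by (auto simp: ESsum simps)
    finally show ?thesis .
  qed
  moreover have "(\<Sum>k<m. ?S k i (?E k j f)) = (if i = j then f else 0)" if ij: "i < n" "j < n" for i j f
  proof -
    \<comment> \<open>The corrections at \<open>k = p\<close> and \<open>k = q\<close> are equal
      with opposite signs, so they cancel in the sum over \<open>k\<close>.\<close>
    have "?S k i (?E k j f) = S k i (E k j f) + (if k = p then S p i (N (E q j f)) else 0)
        - (if k = q then S p i (N (E q j f)) else 0)" for k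
      using pq by (auto simp: simps)
    then have "(\<Sum>k<m. ?S k i (?E k j f)) = (\<Sum>k<m. S k i (E k j f))"
      using pq by (simp add: sum.distrib sum_subtractf)
    then show ?thesis
      using ij by (simp add: SEsum)
  qed
  ultimately show ?thesis
    unfolding leavitt_matrices_def by blast
qed

text \<open>A map \<open>\<beta>\<close> acts on families of sequences by pullback; \<open>block \<beta> i j\<close> is its matrix entry from
  the \<open>i\<close>-th to the \<open>j\<close>-th sequence.\<close>
definition block :: "(nat \<times> nat \<Rightarrow> nat \<times> nat) \<Rightarrow> nat \<Rightarrow> nat \<Rightarrow> (nat \<Rightarrow> 'k::field) \<Rightarrow> nat \<Rightarrow> 'k" where
  "block \<beta> i j f = (\<lambda>t. if fst (\<beta> (j, t)) = i then f (snd (\<beta> (j, t))) else 0)"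

lemma flinear_block: "flinear (block \<beta> i j)"
  by (auto simp: flinear_iff block_def fscale_def fun_eq_iff)

lemma sum_fun_apply: "(\<Sum>i\<in>I. F i) x = (\<Sum>i\<in>I. F i x :: 'a::comm_monoid_add)"
  by (induction I rule: infinite_finite_induct) auto

text \<open>At coordinate \<open>t\<close> only the summand \<open>k = fst (\<gamma> (i, t))\<close>
  contributes, and there \<open>\<beta>\<close> leads back to \<open>(i, t)\<close>.\<close>

lemma sum_block_inverse:
  assumes "\<And>t. fst (\<gamma> (i, t)) < n \<and> \<beta> (\<gamma> (i, t)) = (i, t)"
  shows "(\<Sum>k<n. block \<gamma> k i (block \<beta> j k f)) = (if i = j then f else 0)"
proof
  fix t
  have "(\<Sum>k<n. block \<gamma> k i (block \<beta> j k f)) t =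
      (\<Sum>k<n. if fst (\<gamma> (i, t)) = k then block \<beta> j k f (snd (\<gamma> (i, t))) else 0)"
    unfolding sum_fun_apply by (simp add: block_def)
  also have "\<dots> = block \<beta> j (fst (\<gamma> (i, t))) f (snd (\<gamma> (i, t)))"
    using assms[of t] by simp
  also have "\<dots> = (if i = j then f else 0) t"
    using assms[of t] by (auto simp: block_def)
  finally show "(\<Sum>k<n. block \<gamma> k i (block \<beta> j k f)) t = (if i = j then f else 0) t" .
qed

text \<open>Pullbacks along a bijection and along its inverse are mutually inverse. The indices of
  \<open>block \<gamma>\<close> are exchanged because \<open>E i j\<close> leads from the
  \<open>j\<close>-th to the \<open>i\<close>-th sequence.\<close>

lemma leavitt_matrices_block:
  assumes \<beta>: "bij_betw \<beta> ({..<n} \<times> UNIV) ({..<m} \<times> UNIV)"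
    and \<gamma>: "\<gamma> = inv_into ({..<n} \<times> UNIV) \<beta>"
  shows "leavitt_matrices m n (\<lambda>i j. block \<gamma> j i) (block \<beta>)"
proof -
  have "fst (\<gamma> (i, t)) < n \<and> \<beta> (\<gamma> (i, t)) = (i, t)" if "i < m" for i t
    using bij_betwE[OF bij_betw_inv_into[OF \<beta>]] bij_betw_inv_into_right[OF \<beta>, of "(i, t)"] that
    by (auto simp: \<gamma> mem_Times_iff)
  moreover have "fst (\<beta> (j, t)) < m \<and> \<gamma> (\<beta> (j, t)) = (j, t)" if "j < n" for j t
    using bij_betwE[OF \<beta>] bij_betw_inv_into_left[OF \<beta>, of "(j, t)"] that
    by (auto simp: \<gamma> mem_Times_iff)
  ultimately show ?thesis
    unfolding leavitt_matrices_def by (simp add: flinear_block sum_block_inverse)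
qed

lemma bij_betw_countably_infinite:
  assumes "countable A" "infinite A" "countable B" "infinite B"
  obtains f where "bij_betw f A B"
  using assms by (metis bij_betw_trans countableE_infinite countable_infiniteE')

lemma infinite_Times_UNIV: "A \<noteq> {} \<Longrightarrow> infinite (A \<times> (UNIV :: nat set))"
  by (simp add: finite_cartesian_product_iff)

text \<open>Finite nonempty unions of copies of the natural numbers are in bijection, whatever the
  numbers of copies.\<close>

lemma ex_leavitt_matrices:
  assumes "m > 0" "n > 0"
  shows "\<exists>E S :: nat \<Rightarrow> nat \<Rightarrow> (nat \<Rightarrow> 'k::field) \<Rightarrow> nat \<Rightarrow> 'k. leavitt_matrices m n E S"
proof -
  have "infinite ({..<n} \<times> (UNIV :: nat set))" "infinite ({..<m} \<times> (UNIV :: nat set))"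
    using assms by (auto intro!: infinite_Times_UNIV simp: lessThan_empty_iff)
  then obtain \<beta> where "bij_betw \<beta> ({..<n} \<times> (UNIV :: nat set)) ({..<m} \<times> (UNIV :: nat set))"
    using bij_betw_countably_infinite countableI_type by metis
  then show ?thesis
    using leavitt_matrices_block by blast
qed

section \<open>Matrices with shifts as entries\<close>

definition shl :: "(nat \<Rightarrow> 'k::field) \<Rightarrow> nat \<Rightarrow> 'k" where
  "shl f = (\<lambda>t. f (Suc t))"

definition shr :: "(nat \<Rightarrow> 'k::field) \<Rightarrow> nat \<Rightarrow> 'k" where
  "shr f = (\<lambda>t. case t of 0 \<Rightarrow> 0 | Suc s \<Rightarrow> f s)"

lemma shl_shr [simp]: "shl (shr f) = f"
  by (simp add: shl_def shr_def)

lemma flinear_shl: "flinear shl"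
  by (auto simp: flinear_iff shl_def fscale_def fun_eq_iff)

lemma flinear_shr: "flinear shr"
  by (auto simp: flinear_iff shr_def fscale_def fun_eq_iff split: nat.splits)

text \<open>The bijection is prescribed on copy \<open>y\<close>, where it sends
  \<open>(y, t)\<close> to \<open>(q, Suc t)\<close>, and is arbitrary elsewhere. By
  \<open>2 \<le> n\<close> and \<open>2 \<le> m\<close> the remaining sets \<open>?A\<close> and
  \<open>?B\<close> are infinite, so such a bijection exists.\<close>

lemma ex_leavitt_matrices_shift:
  assumes "2 \<le> m" "2 \<le> n" "q < m" "y < n"
  obtains E S :: "nat \<Rightarrow> nat \<Rightarrow> (nat \<Rightarrow> 'k::field) \<Rightarrow> nat \<Rightarrow> 'k"
  where "leavitt_matrices m n E S" "E q y = shr" "S q y = shl"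
    "\<And>i. i < m \<Longrightarrow> i \<noteq> q \<Longrightarrow> E i y = (\<lambda>f. 0) \<and> S i y = (\<lambda>f. 0)"
proof -
  let ?A = "({..<n} - {y}) \<times> (UNIV :: nat set)" and ?B = "{..<m} \<times> UNIV - {q} \<times> range Suc"
  have "{..<k} - {x} \<noteq> {}" if "2 \<le> k" for k x :: nat
  proof -
    have "(if x = 0 then 1 else 0) \<in> {..<k} - {x}"
      using that by auto
    then show ?thesis by blast
  qed
  then have "{..<n} - {y} \<noteq> {}" "{..<m} - {q} \<noteq> {}"
    using assms by blast+
  then have "infinite ?A" "infinite (({..<m} - {q}) \<times> (UNIV :: nat set))"
    by (simp_all only: infinite_Times_UNIV not_False_eq_True)
  moreover have "({..<m} - {q}) \<times> (UNIV :: nat set) \<subseteq> ?B"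
    by auto
  ultimately have "infinite ?A" "infinite ?B"
    using infinite_super by blast+
  then obtain \<beta>' where \<beta>': "bij_betw \<beta>' ?A ?B"
    by (meson bij_betw_countably_infinite countableI_type)
  define \<beta> where "\<beta> = (\<lambda>(j, t). if j = y then (q, Suc t) else \<beta>' (j, t))"
  have "bij_betw \<beta> ?A ?B"
    using \<beta>' bij_betw_cong[of ?A \<beta> \<beta>' ?B] by (auto simp: \<beta>_def)
  moreover have "bij_betw \<beta> ({y} \<times> UNIV) ({q} \<times> range Suc)"
    by (auto simp: bij_betw_def inj_on_def \<beta>_def image_iff)
  ultimately have "bij_betw \<beta> (?A \<union> {y} \<times> UNIV) (?B \<union> {q} \<times> range Suc)"
    by (rule bij_betw_combine) auto
  moreover have "?A \<union> {y} \<times> UNIV = {..<n} \<times> UNIV" "?B \<union> {q} \<times> range Suc = {..<m} \<times> UNIV"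
    using assms by auto
  ultimately have bij: "bij_betw \<beta> ({..<n} \<times> UNIV) ({..<m} \<times> UNIV)"
    by simp
  define \<gamma> where "\<gamma> = inv_into ({..<n} \<times> UNIV) \<beta>"
  have y: "\<beta> (y, t) = (q, Suc t)" for t
    by (simp add: \<beta>_def)
  have \<gamma>_q: "\<gamma> (q, Suc t) = (y, t)" for t
    using bij_betw_inv_into_left[OF bij, of "(y, t)"] assms by (simp add: y \<gamma>_def)
  \<comment> \<open>The point \<open>(q, 0)\<close> is missed by copy \<open>y\<close>; this is the
    entry that \<open>shr\<close> fills with \<open>0\<close>.\<close>
  have \<gamma>_not_y: "fst (\<gamma> (i, t)) \<noteq> y" if "i < m" "i = q \<longrightarrow> t = 0" for i t
  proof
    assume "fst (\<gamma> (i, t)) = y"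
    then obtain s where "\<gamma> (i, t) = (y, s)" by (metis prod.collapse)
    moreover have "\<beta> (\<gamma> (i, t)) = (i, t)"
      using bij_betw_inv_into_right[OF bij, of "(i, t)"] that by (simp add: \<gamma>_def)
    ultimately show False using that by (simp add: y)
  qed
  show thesis
  proof (rule that[OF leavitt_matrices_block[OF bij \<gamma>_def]])
    show "block \<gamma> y q = (shr :: (nat \<Rightarrow> 'k) \<Rightarrow> nat \<Rightarrow> 'k)"
      using assms by (auto simp: block_def shr_def fun_eq_iff \<gamma>_q \<gamma>_not_y split: nat.splits)
    show "block \<beta> q y = (shl :: (nat \<Rightarrow> 'k) \<Rightarrow> nat \<Rightarrow> 'k)"
      by (auto simp: block_def shl_def fun_eq_iff y)
  next
    fix i assume "i < m" "i \<noteq> q"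
    then show "block \<gamma> y i = (\<lambda>f :: nat \<Rightarrow> 'k. 0) \<and> block \<beta> i y = (\<lambda>f :: nat \<Rightarrow> 'k. 0)"
      by (auto simp: block_def fun_eq_iff y \<gamma>_not_y)
  qed
qed

text \<open>Adding \<open>shl\<close> times row \<open>q\<close> to row \<open>p\<close> turns the
  zero entry \<open>E p y\<close> into \<open>shl\<close> after \<open>shr\<close>, the identity,
  and leaves \<open>S q y = shl\<close> because \<open>S p y\<close> is zero.\<close>

lemma ex_leavitt_matrices_left:
  assumes "2 \<le> m" "2 \<le> n" "p < m" "q < m" "p \<noteq> q" "y < n"
  obtains E S :: "nat \<Rightarrow> nat \<Rightarrow> (nat \<Rightarrow> 'k::field) \<Rightarrow> nat \<Rightarrow> 'k"
  where "leavitt_matrices m n E S"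
    "\<And>f. E p y (S q y f) = shl f" "\<And>f. E q y (S q y f) = shr (shl f)"
proof -
  obtain E S :: "nat \<Rightarrow> nat \<Rightarrow> (nat \<Rightarrow> 'k) \<Rightarrow> nat \<Rightarrow> 'k"
    where ES: "leavitt_matrices m n E S" "E q y = shr" "S q y = shl"
      "\<And>i. i < m \<Longrightarrow> i \<noteq> q \<Longrightarrow> E i y = (\<lambda>f. 0) \<and> S i y = (\<lambda>f. 0)"
    using ex_leavitt_matrices_shift assms by metis
  show thesis
    using assms(5) ES(2,3) ES(4)[OF assms(3,5)]
    by (intro that[OF leavitt_matrices_row_operation[OF ES(1) assms(3-5) flinear_shl]]) auto
qed

text \<open>Here a multiple of row \<open>p\<close> is added to row \<open>q\<close>. The factor
  \<open>- shr\<close> turns the zero entry \<open>S p y\<close> into \<open>shl\<close> after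
  \<open>shr\<close>, the identity, and \<open>E q y = shr\<close> stays because
  \<open>E p y\<close> is zero.\<close>

lemma ex_leavitt_matrices_right:
  assumes "2 \<le> m" "2 \<le> n" "p < m" "q < m" "p \<noteq> q" "y < n"
  obtains E S :: "nat \<Rightarrow> nat \<Rightarrow> (nat \<Rightarrow> 'k::field) \<Rightarrow> nat \<Rightarrow> 'k"
  where "leavitt_matrices m n E S"
    "\<And>f. E q y (S p y f) = shr f" "\<And>f. E q y (S q y f) = shr (shl f)"
proof -
  obtain E S :: "nat \<Rightarrow> nat \<Rightarrow> (nat \<Rightarrow> 'k) \<Rightarrow> nat \<Rightarrow> 'k"
    where ES: "leavitt_matrices m n E S" "E q y = shr" "S q y = shl"
      "\<And>i. i < m \<Longrightarrow> i \<noteq> q \<Longrightarrow> E i y = (\<lambda>f. 0) \<and> S i y = (\<lambda>f. 0)"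
    using ex_leavitt_matrices_shift assms by metis
  have lin: "flinear (\<lambda>f :: nat \<Rightarrow> 'k. - shr f)"
    by (intro flinear_uminus flinear_shr)
  show thesis
    using assms(5) ES(2,3) ES(4)[OF assms(3,5)]
    by (intro that[OF leavitt_matrices_row_operation[OF ES(1) assms(4,3) assms(5)[symmetric] lin]])
      (auto simp: flinear_simps(3)[OF flinear_shl] flinear_simps(4)[OF flinear_shr])
qed

section \<open>Representations of Leavitt path algebras\<close>

text \<open>Families of sequences indexed by vertices are stored as functions on pairs;
  \<open>place v\<close> and \<open>component v\<close> are the inclusion and the projection of the
  copy at \<open>v\<close>.\<close>

definition place :: "'v \<Rightarrow> (nat \<Rightarrow> 'k::field) \<Rightarrow> 'v \<times> nat \<Rightarrow> 'k" where
  "place v f = (\<lambda>(u, t). if u = v then f t else 0)"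

definition component :: "'v \<Rightarrow> ('v \<times> nat \<Rightarrow> 'k::field) \<Rightarrow> nat \<Rightarrow> 'k" where
  "component v f = (\<lambda>t. f (v, t))"

lemma component_place: "component u (place v f) = (if u = v then f else 0)"
  by (auto simp: component_def place_def)

lemma flinear_place: "flinear (place v)"
  by (auto simp: flinear_iff place_def fscale_def fun_eq_iff)

lemma flinear_component: "flinear (component v)"
  by (auto simp: flinear_iff component_def fscale_def fun_eq_iff)

lemmas place_simps = flinear_simps[OF flinear_place]
lemmas component_simps = flinear_simps[OF flinear_component]

text \<open>Operators apply from right to left, so by relation (ii) an edge generator reads at its
  range vertex and writes at its source vertex.\<close>

fun lpa_action ::
    "('h \<Rightarrow> 'v list) \<Rightarrow> ('h \<Rightarrow> 'v list) \<Rightarrow>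
      ('h \<Rightarrow> nat \<Rightarrow> nat \<Rightarrow> (nat \<Rightarrow> 'k::field) \<Rightarrow> nat \<Rightarrow> 'k) \<Rightarrow>
      ('h \<Rightarrow> nat \<Rightarrow> nat \<Rightarrow> (nat \<Rightarrow> 'k) \<Rightarrow> nat \<Rightarrow> 'k) \<Rightarrow>
      ('v, 'h) lpa_gen \<Rightarrow> ('v \<times> nat \<Rightarrow> 'k) \<Rightarrow> 'v \<times> nat \<Rightarrow> 'k" where
  "lpa_action sl rl E S (Vertex v) f = place v (component v f)"
| "lpa_action sl rl E S (Edge h i j) f = place (sl h ! i) (E h i j (component (rl h ! j) f))"
| "lpa_action sl rl E S (Star h i j) f = place (rl h ! j) (S h i j (component (sl h ! i) f))"

text \<open>Linearity is required for all indices, also outside the hypergraph, so that every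
  element of the generator type acts linearly.\<close>

locale lpa_representation =
  fixes H :: "('v, 'h) hypergraph_data" and sl rl :: "'h \<Rightarrow> 'v list"
    and E S :: "'h \<Rightarrow> nat \<Rightarrow> nat \<Rightarrow> (nat \<Rightarrow> 'k::field) \<Rightarrow> nat \<Rightarrow> 'k"
  assumes hypergraph: "hypergraph H" and listings: "listings H sl rl"
    and flinear_entries: "\<And>h i j. flinear (E h i j)" "\<And>h i j. flinear (S h i j)"
    and matrices: "\<And>h. h \<in> edges H \<Longrightarrow> leavitt_matrices (length (sl h)) (length (rl h)) (E h) (S h)"
begin

abbreviation \<phi> :: "('v, 'h) lpa_gen \<Rightarrow> ('v \<times> nat \<Rightarrow> 'k) \<Rightarrow> 'v \<times> nat \<Rightarrow> 'k" where
  "\<phi> \<equiv> lpa_action sl rl E S"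

abbreviation X :: "('v, 'h) lpa_gen set" where
  "X \<equiv> lpa_gens H sl rl"

abbreviation L :: "('k, (('v, 'h) lpa_gen word \<Rightarrow>\<^sub>0 'k) set) module" where
  "L \<equiv> leavitt_path_algebra H sl rl"

lemma flinear_action: "flinear (\<phi> x)"
  unfolding flinear_iff
  by (cases x) (simp_all add: place_simps component_simps flinear_simps[OF flinear_entries(1)]
      flinear_simps[OF flinear_entries(2)])

lemmas act_simps = act_add act_diff act_sum act_gen act_zero act_mult[of \<phi>, OF flinear_action]

lemma vertices:
  assumes "h \<in> edges H"
  shows "i < length (sl h) \<Longrightarrow> sl h ! i \<in> verts H" "j < length (rl h) \<Longrightarrow> rl h ! j \<in> verts H"
proof -
  have "set (sl h) \<subseteq> verts H" "set (rl h) \<subseteq> verts H"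
    using hypergraph listings assms
    by (auto simp: hypergraph_def listings_def Mult_def simp flip: set_mset_mset)
  then show "i < length (sl h) \<Longrightarrow> sl h ! i \<in> verts H" "j < length (rl h) \<Longrightarrow> rl h ! j \<in> verts H"
    by auto
qed

lemma generators:
  "v \<in> verts H \<Longrightarrow> Vertex v \<in> X"
  "\<lbrakk>h \<in> edges H; i < length (sl h); j < length (rl h)\<rbrakk> \<Longrightarrow> Edge h i j \<in> X"
  "\<lbrakk>h \<in> edges H; i < length (sl h); j < length (rl h)\<rbrakk> \<Longrightarrow> Star h i j \<in> X"
  by (auto simp: lpa_gens_def)

lemma rels_free: "lpa_rels H sl rl \<subseteq> (free_carrier X :: (('v, 'h) lpa_gen word \<Rightarrow>\<^sub>0 'k) set)"
proof
  fix r :: "('v, 'h) lpa_gen word \<Rightarrow>\<^sub>0 'k"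
  assume "r \<in> lpa_rels H sl rl"
  then show "r \<in> free_carrier X"
    unfolding lpa_rels_def
    by (auto intro!: diff_in_free mult_in_free sum_in_free gen_in_free zero_in_free generators vertices
        simp del: free_algebra_simps)
qed

text \<open>Relations (i) and (ii) follow from \<open>component_place\<close>. In (iii) and (iv) the
  sum is pulled under \<open>place\<close>, where it becomes a sum from
  \<open>leavitt_matrices\<close>.\<close>

lemma act_rels:
  assumes "r \<in> lpa_rels H sl rl"
  shows "act \<phi> r f = 0"
proof -
  have ES: "(\<Sum>k<length (rl h). E h i k (S h j k g)) = (if i = j then g else 0)"
    if "h \<in> edges H" "i < length (sl h)" "j < length (sl h)" for h i j g
    using matrices[OF that(1)] that by (simp add: leavitt_matrices_def)
  have SE: "(\<Sum>k<length (sl h). S h k i (E h k j g)) = (if i = j then g else 0)"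
    if "h \<in> edges H" "i < length (rl h)" "j < length (rl h)" for h i j g
    using matrices[OF that(1)] that by (simp add: leavitt_matrices_def)
  have 0: "E h i j 0 = 0" "S h i j 0 = 0" for h i j
    by (rule flinear_simps(4)[OF flinear_entries(1)], rule flinear_simps(4)[OF flinear_entries(2)])
  show ?thesis
    using assms unfolding lpa_rels_def
    by (auto simp: act_simps component_place place_simps 0 ES SE simp flip: place_simps(6))
qed

section \<open>Strict chains of one-sided ideals from shifts at a vertex\<close>

context
  fixes v d
  assumes v: "v \<in> verts H" and d: "d \<in> free_carrier X"
    and act_d: "\<And>f. act \<phi> d f = place v (shr (shl (component v f)))"
begin

abbreviation b where "b \<equiv> gen (Vertex v) - d"

lemma b_free: "b \<in> free_carrier X"
  by (intro diff_in_free gen_in_free generators v d)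

lemma act_b: "act \<phi> b f = place v (\<lambda>t. if t = 0 then f (v, 0) else 0)"
  by (auto simp: act_simps act_d place_def component_def shr_def shl_def fun_eq_iff split: nat.splits)

lemma not_left_noetherian:
  assumes a: "a \<in> free_carrier X" and act_a: "\<And>f. act \<phi> a f = place v (shl (component v f))"
  shows "\<not> left_noetherian L"
proof -
  define e :: "nat \<Rightarrow> 'v \<times> nat \<Rightarrow> 'k" where
    "e k = place v (\<lambda>t. if t = k then 1 else 0)" for k
  have e_Suc: "act \<phi> a (e (Suc k)) = e k" for k
    by (simp add: act_a e_def component_place) (simp add: shl_def)
  have e_0: "act \<phi> a (e 0) = 0"
    by (simp add: act_a e_def component_place) (auto simp: shl_def place_def fun_eq_iff)
  \<comment> \<open>Each factor \<open>a\<close> lowers the index by one and \<open>b\<close> keeps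
    only \<open>e 0\<close>. The indices \<open>k \<ge> n\<close> are those of the test vectors in
    \<open>F n\<close> below.\<close>
  have power: "act \<phi> (b * a ^ n) (e k) = (if k = n then e 0 else 0)" if "k \<ge> n" for n k
    using that
  proof (induction n arbitrary: k)
    case 0
    then show ?case by (auto simp: act_b e_def place_def fun_eq_iff)
  next
    case (Suc n)
    then obtain l where "k = Suc l" "n \<le> l" by (cases k) auto
    \<comment> \<open>\<open>power_Suc2\<close> splits off the rightmost factor \<open>a\<close>,
      which acts first.\<close>
    then show ?case
      using Suc.IH[of l] by (simp add: power_Suc2 act_simps e_Suc mult.assoc[symmetric] del: power_Suc)
  qed
  \<comment> \<open>The factor \<open>a ^ 0\<close> is the empty word, which lies outside the
    carrier, so membership is shown for the whole product.\<close>
  have free: "b * a ^ n \<in> free_carrier X" for n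
  proof (induction n)
    case (Suc n)
    then show ?case
      using a by (simp add: power_Suc2 mult_in_free mult.assoc[symmetric] del: power_Suc)
  qed (use b_free in simp)
  have "e 0 (v, 0) = 1"
    by (simp add: e_def place_def)
  then have "e 0 \<noteq> 0" by auto
  with free show ?thesis
    unfolding leavitt_path_algebra_def
    by (intro not_left_noetherian_presented[OF flinear_action rels_free act_rels,
          where F = "\<lambda>n. e ` {n..}" and x = "\<lambda>n. b * a ^ n"]) (auto simp: power)
qed

lemma not_right_noetherian:
  assumes c: "c \<in> free_carrier X" and act_c: "\<And>f. act \<phi> c f = place v (shr (component v f))"
  shows "\<not> right_noetherian L"
proof -
  define W :: "nat \<Rightarrow> ('v \<times> nat \<Rightarrow> 'k) set" where "W n = {f. \<forall>k\<ge>n. f (v, k) = 0}" for n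
  have subspace: "fscale.subspace (W n)" for n
    by (auto simp: fscale.subspace_def W_def fscale_def)
  have power: "act \<phi> (c ^ n * b) f = place v (\<lambda>t. if t = n then f (v, 0) else 0)" for n f
  proof (induction n)
    case 0
    show ?case by (simp add: act_b)
  next
    case (Suc n)
    then show ?case
      by (simp add: act_simps act_c component_place mult.assoc)
        (auto simp: place_def shr_def fun_eq_iff split: nat.splits)
  qed
  have free: "c ^ n * b \<in> free_carrier X" for n
    by (induction n) (use b_free c in \<open>auto simp: mult_in_free mult.assoc\<close>)
  \<comment> \<open>The constant sequence has a nonzero entry at \<open>0\<close>, which the product
    moves to position \<open>n\<close>.\<close>
  have "act \<phi> (c ^ n * b) (place v (\<lambda>t. 1)) \<notin> W n" for n
    by (simp add: power W_def) (auto simp: place_def)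
  then show ?thesis
    unfolding leavitt_path_algebra_def
    by (intro not_right_noetherian_presented[OF flinear_action rels_free act_rels,
          where W = W and x = "\<lambda>n. c ^ n * b"] exI[of _ "place v (\<lambda>t. 1)"] subspace free)
      (auto simp: power W_def place_def)
qed

end

end

section \<open>Chains of one-sided ideals in Leavitt path algebras\<close>

text \<open>No relation involves two different hyperedges, so the matrices of \<open>h\<close> can
  be prescribed and those of the others chosen independently.\<close>

lemma ex_lpa_representation:
  fixes E\<^sub>0 S\<^sub>0 :: "nat \<Rightarrow> nat \<Rightarrow> (nat \<Rightarrow> 'k::field) \<Rightarrow> nat \<Rightarrow> 'k"
  assumes H: "hypergraph H" "listings H sl rl"
    and h: "leavitt_matrices (length (sl h)) (length (rl h)) E\<^sub>0 S\<^sub>0"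
  obtains E S where "lpa_representation H sl rl E S" "E h = E\<^sub>0" "S h = S\<^sub>0"
proof -
  \<comment> \<open>Size \<open>1\<close> outside \<open>edges H\<close> is a default that supplies
    linear entries there too.\<close>
  have "\<exists>M. leavitt_matrices (if g \<in> edges H then length (sl g) else 1)
      (if g \<in> edges H then length (rl g) else 1) (fst M) (snd M :: nat \<Rightarrow> nat \<Rightarrow> (nat \<Rightarrow> 'k) \<Rightarrow> nat \<Rightarrow> 'k)" for g
  proof -
    have "mset (sl g) \<noteq> {#}" "mset (rl g) \<noteq> {#}" if "g \<in> edges H"
      using H that by (auto simp: hypergraph_def listings_def Mult_def)
    then have "(if g \<in> edges H then length (sl g) else 1) > 0" "(if g \<in> edges H then length (rl g) else 1) > 0"
      by auto
    then show ?thesis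
      using ex_leavitt_matrices by (metis fst_conv snd_conv)
  qed
  then obtain M where M: "\<And>g. leavitt_matrices (if g \<in> edges H then length (sl g) else 1)
      (if g \<in> edges H then length (rl g) else 1) (fst (M g)) (snd (M g) :: nat \<Rightarrow> nat \<Rightarrow> (nat \<Rightarrow> 'k) \<Rightarrow> nat \<Rightarrow> 'k)"
    by metis
  define M' where "M' = M(h := (E\<^sub>0, S\<^sub>0))"
  have "flinear (fst (M' g) i j)" "flinear (snd (M' g) i j)" for g i j
    using M[of g] h by (auto simp: M'_def leavitt_matrices_def)
  moreover have "leavitt_matrices (length (sl g)) (length (rl g)) (fst (M' g)) (snd (M' g))" if "g \<in> edges H" for g
    using M[of g] h that by (auto simp: M'_def)
  ultimately have "lpa_representation H sl rl (fst \<circ> M') (snd \<circ> M')"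
    using H by (simp add: lpa_representation_def)
  then show thesis
    by (rule that) (simp_all add: M'_def)
qed

lemma proper_mset_indices:
  assumes "proper_mset (mset xs)"
  obtains p q where "p < length xs" "q < length xs" "p \<noteq> q" "xs ! p = xs ! q"
proof -
  have "is_set_mset (mset xs)" if "distinct xs"
    using that by (simp add: is_set_mset_def distinct_count_atmost_1)
  then have "\<not> distinct xs"
    using assms by blast
  then show thesis
    using that by (auto simp: distinct_conv_nth)
qed

theorem theorem59:
  fixes H :: "('v, 'h) hypergraph_data"
    and sl rl :: "'h \<Rightarrow> 'v list"
    and L :: "('k::field, (('v, 'h) lpa_gen word \<Rightarrow>\<^sub>0 'k) set) module"
  assumes "hypergraph H"
    and "listings H sl rl"
    and "\<exists>h\<in>edges H. size (src H h) \<ge> 2 \<and> size (rng H h) \<ge> 2 \<and>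
           (proper_mset (src H h) \<or> proper_mset (rng H h) \<or>
            (is_set_mset (src H h) \<and> is_set_mset (rng H h) \<and>
             set_mset (src H h) \<inter> set_mset (rng H h) \<noteq> {}))"
    and "L = leavitt_path_algebra H sl rl"
  shows "\<not> left_noetherian L \<and> \<not> right_noetherian L"
proof -
  note H = assms(1,2)
  obtain h where h: "h \<in> edges H" and size: "size (src H h) \<ge> 2" "size (rng H h) \<ge> 2"
    and cases: "proper_mset (src H h) \<or> proper_mset (rng H h) \<or>
             set_mset (src H h) \<inter> set_mset (rng H h) \<noteq> {}"
    using assms(3) by blast
  have src: "src H h = mset (sl h)" and rng: "rng H h = mset (rl h)"
    using H(2) h by (auto simp: listings_def)
  have len: "2 \<le> length (sl h)" "2 \<le> length (rl h)"
    using size by (auto simp: src rng)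
  consider (source) "proper_mset (mset (sl h))" | (range) "proper_mset (mset (rl h))"
    | (common) "set (sl h) \<inter> set (rl h) \<noteq> {}"
    using cases by (auto simp: src rng)
  then show ?thesis
  proof cases
    case source
    then obtain p q where pq: "p < length (sl h)" "q < length (sl h)" "p \<noteq> q" "sl h ! p = sl h ! q"
      by (rule proper_mset_indices)
    have y: "0 < length (rl h)" using len by linarith
    \<comment> \<open>Positions \<open>p\<close> and \<open>q\<close> carry the same vertex
      \<open>?v\<close>, so for indices among them \<open>?w i j\<close> acts at \<open>?v\<close>
      as \<open>E i 0\<close> after \<open>S j 0\<close>.\<close>
    let ?v = "sl h ! q" and ?w = "\<lambda>i j. gen (Edge h i 0) * gen (Star h j 0)"
    obtain E S :: "nat \<Rightarrow> nat \<Rightarrow> (nat \<Rightarrow> 'k) \<Rightarrow> nat \<Rightarrow> 'k"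
      where ES: "leavitt_matrices (length (sl h)) (length (rl h)) E S"
        "\<And>f. E p 0 (S q 0 f) = shl f" "\<And>f. E q 0 (S q 0 f) = shr (shl f)"
      using ex_leavitt_matrices_left[OF len pq(1-3) y] by blast
    obtain EE SS where rep: "lpa_representation H sl rl EE SS" and eq: "EE h = E" "SS h = S"
      using ex_lpa_representation[OF H ES(1)] by blast
    interpret left: lpa_representation H sl rl EE SS by (rule rep)
    have "\<not> left_noetherian left.L"
      using pq y h
      by (intro left.not_left_noetherian[where v = ?v and d = "?w q q" and a = "?w p q"]
          mult_in_free gen_in_free left.generators left.vertices)
        (simp_all add: left.act_simps component_place eq ES)
    \<comment> \<open>A second representation of the same algebra, in which \<open>?w q p\<close>
      acts as \<open>shr\<close>, serves the right ideals.\<close>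
    obtain E' S' :: "nat \<Rightarrow> nat \<Rightarrow> (nat \<Rightarrow> 'k) \<Rightarrow> nat \<Rightarrow> 'k"
      where ES': "leavitt_matrices (length (sl h)) (length (rl h)) E' S'"
        "\<And>f. E' q 0 (S' p 0 f) = shr f" "\<And>f. E' q 0 (S' q 0 f) = shr (shl f)"
      using ex_leavitt_matrices_right[OF len pq(1-3) y] by blast
    obtain EE' SS' where rep': "lpa_representation H sl rl EE' SS'" and eq': "EE' h = E'" "SS' h = S'"
      using ex_lpa_representation[OF H ES'(1)] by blast
    interpret right: lpa_representation H sl rl EE' SS' by (rule rep')
    have "\<not> right_noetherian right.L"
      using pq y h
      by (intro right.not_right_noetherian[where v = ?v and d = "?w q q" and c = "?w q p"]
          mult_in_free gen_in_free right.generators right.vertices)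
        (simp_all add: right.act_simps component_place eq' ES')
    then show ?thesis
      using \<open>\<not> left_noetherian left.L\<close> by (simp add: assms(4))
  next
    case range
    then obtain p q where pq: "p < length (rl h)" "q < length (rl h)" "p \<noteq> q" "rl h ! p = rl h ! q"
      by (rule proper_mset_indices)
    have y: "0 < length (sl h)" using len by linarith
    \<comment> \<open>After the swap a star generator acts by an entry of \<open>E\<close> and an
      edge generator by an entry of \<open>S\<close>, so \<open>?w i j\<close> is again
      \<open>E i 0\<close> after \<open>S j 0\<close> at \<open>?v\<close>.\<close>
    let ?v = "rl h ! q" and ?w = "\<lambda>i j. gen (Star h 0 i) * gen (Edge h 0 j)"
    obtain E S :: "nat \<Rightarrow> nat \<Rightarrow> (nat \<Rightarrow> 'k) \<Rightarrow> nat \<Rightarrow> 'k"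
      where ES: "leavitt_matrices (length (rl h)) (length (sl h)) E S"
        "\<And>f. E p 0 (S q 0 f) = shl f" "\<And>f. E q 0 (S q 0 f) = shr (shl f)"
      using ex_leavitt_matrices_left[OF len(2,1) pq(1-3) y] by blast
    obtain EE SS where rep: "lpa_representation H sl rl EE SS"
      and eq: "EE h = (\<lambda>i j. S j i)" "SS h = (\<lambda>i j. E j i)"
      using ex_lpa_representation[OF H leavitt_matrices_swap[OF ES(1)]] by blast
    interpret left: lpa_representation H sl rl EE SS by (rule rep)
    have "\<not> left_noetherian left.L"
      using pq y h
      by (intro left.not_left_noetherian[where v = ?v and d = "?w q q" and a = "?w p q"]
          mult_in_free gen_in_free left.generators left.vertices)
        (simp_all add: left.act_simps component_place eq ES)
    obtain E' S' :: "nat \<Rightarrow> nat \<Rightarrow> (nat \<Rightarrow> 'k) \<Rightarrow> nat \<Rightarrow> 'k"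
      where ES': "leavitt_matrices (length (rl h)) (length (sl h)) E' S'"
        "\<And>f. E' q 0 (S' p 0 f) = shr f" "\<And>f. E' q 0 (S' q 0 f) = shr (shl f)"
      using ex_leavitt_matrices_right[OF len(2,1) pq(1-3) y] by blast
    obtain EE' SS' where rep': "lpa_representation H sl rl EE' SS'"
      and eq': "EE' h = (\<lambda>i j. S' j i)" "SS' h = (\<lambda>i j. E' j i)"
      using ex_lpa_representation[OF H leavitt_matrices_swap[OF ES'(1)]] by blast
    interpret right: lpa_representation H sl rl EE' SS' by (rule rep')
    have "\<not> right_noetherian right.L"
      using pq y h
      by (intro right.not_right_noetherian[where v = ?v and d = "?w q q" and c = "?w q p"]
          mult_in_free gen_in_free right.generators right.vertices)
        (simp_all add: right.act_simps component_place eq' ES')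
    then show ?thesis
      using \<open>\<not> left_noetherian left.L\<close> by (simp add: assms(4))
  next
    case common
    then obtain q y where qy: "q < length (sl h)" "y < length (rl h)" "rl h ! y = sl h ! q"
      by (auto simp: in_set_conv_nth) metis
    \<comment> \<open>Both generators map the copy at the common vertex to itself, as
      \<open>shr\<close> and \<open>shl\<close>, so one representation serves both sides.\<close>
    let ?v = "sl h ! q" and ?c = "gen (Edge h q y)" and ?a = "gen (Star h q y)"
    obtain E S :: "nat \<Rightarrow> nat \<Rightarrow> (nat \<Rightarrow> 'k) \<Rightarrow> nat \<Rightarrow> 'k"
      where ES: "leavitt_matrices (length (sl h)) (length (rl h)) E S" "E q y = shr" "S q y = shl"
      using ex_leavitt_matrices_shift[OF len qy(1,2)] by metis
    obtain EE SS where rep: "lpa_representation H sl rl EE SS" and eq: "EE h = E" "SS h = S"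
      using ex_lpa_representation[OF H ES(1)] by blast
    interpret R: lpa_representation H sl rl EE SS by (rule rep)
    have "\<not> left_noetherian R.L"
      using qy h
      by (intro R.not_left_noetherian[where v = ?v and d = "?c * ?a" and a = ?a]
          mult_in_free gen_in_free R.generators R.vertices)
        (simp_all add: R.act_simps component_place eq ES)
    moreover have "\<not> right_noetherian R.L"
      using qy h
      by (intro R.not_right_noetherian[where v = ?v and d = "?c * ?a" and c = ?c]
          mult_in_free gen_in_free R.generators R.vertices)
        (simp_all add: R.act_simps component_place eq ES)
    ultimately show ?thesis
      by (simp add: assms(4))
  qed
qed

end
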